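(* Let $r,s\in\mathbb{C}^*$ with $r^2\neq s^2$. The algebra $U^+_{r,s}(B_2)$ is a polynomial identity (PI) algebra if and only if $r$ and $s$ are both roots of unity.
   Context: For $r,s\in\mathbb{C}^*$, $U^+_{r,s}(B_2)$ is the unital associative $\mathbb{C}$-algebra generated by $e_1,e_2$ subject to $$e_1^2 e_2-(r^2+s^2)e_1e_2e_1+r^2s^2e_2e_1^2=0,$$ $$e_1e_2^3-(r^2+rs+s^2)e_2e_1e_2^2+rs(r^2+rs+s^2)e_2^2e_1e_2-r^3s^3e_2^3e_1=0.$$ *)

theory Defs
  imports Complex_Main "HOL-Library.Poly_Mapping" "HOL-Algebra.QuotRing" "HOL-Algebra.Module" "HOL-Algebra.Algebraic_Closure_Type"
begin

section \<open>Unital associative algebras and polynomial identities\<close>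

text \<open>The library locale \<^locale>\<open>algebra\<close> is restricted to commutative algebras.\<close>

locale assoc_algebra = module R M + M: ring M for R (structure) and M (structure) +
  assumes smult_mult_left:
      "\<lbrakk>c \<in> carrier R; x \<in> carrier M; y \<in> carrier M\<rbrakk> \<Longrightarrow>
      (c \<odot>\<^bsub>M\<^esub> x) \<otimes>\<^bsub>M\<^esub> y = c \<odot>\<^bsub>M\<^esub> (x \<otimes>\<^bsub>M\<^esub> y)"
    and smult_mult_right:
      "\<lbrakk>c \<in> carrier R; x \<in> carrier M; y \<in> carrier M\<rbrakk> \<Longrightarrow>
      x \<otimes>\<^bsub>M\<^esub> (c \<odot>\<^bsub>M\<^esub> y) = c \<odot>\<^bsub>M\<^esub> (x \<otimes>\<^bsub>M\<^esub> y)"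

text \<open>Words form the free monoid. It is written additively, because \<^typ>\<open>'a \<Rightarrow>\<^sub>0 'b\<close> is the
  monoid algebra (with convolution as product) of an additively written exponent monoid.\<close>

datatype 'v word = Word (letters: "'v list")

instantiation word :: (type) monoid_add
begin

definition zero_word :: "'a word" where "zero_word = Word []"

definition plus_word :: "'a word \<Rightarrow> 'a word \<Rightarrow> 'a word"
  where "plus_word u v = Word (letters u @ letters v)"

instance by standard (auto simp: zero_word_def plus_word_def)

end

type_synonym ('v, 'k) free_algebra = "'v word \<Rightarrow>\<^sub>0 'k"

definition gen :: "'v \<Rightarrow> ('v, 'k::semiring_1) free_algebra"
  where "gen v = Poly_Mapping.single (Word [v]) 1"

definition scalar :: "'k::semiring_1 \<Rightarrow> ('v, 'k) free_algebra"
  where "scalar c = Poly_Mapping.single 0 c"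

definition eval_word :: "('k, 'a, 'm) module_scheme \<Rightarrow> ('v \<Rightarrow> 'a) \<Rightarrow> 'v word \<Rightarrow> 'a"
  where "eval_word A x w = foldr (\<lambda>v a. x v \<otimes>\<^bsub>A\<^esub> a) (letters w) \<one>\<^bsub>A\<^esub>"

definition eval_free ::
    "('k::zero, 'a, 'm) module_scheme \<Rightarrow> ('v \<Rightarrow> 'a) \<Rightarrow> ('v, 'k) free_algebra \<Rightarrow> 'a"
  where "eval_free A x f =
    (\<Oplus>\<^bsub>A\<^esub> w \<in> Poly_Mapping.keys f. Poly_Mapping.lookup f w \<odot>\<^bsub>A\<^esub> eval_word A x w)"

text \<open>Polynomial identities have coefficients in the ground field and use the countably many
  noncommuting indeterminates \<^term>\<open>gen i\<close> for \<^term>\<open>i :: nat\<close>; constant terms are allowed.\<close>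

definition PI_algebra :: "('k::field, 'a, 'm) module_scheme \<Rightarrow> bool"
  where "PI_algebra A \<longleftrightarrow>
    (\<exists>f :: (nat, 'k) free_algebra. f \<noteq> 0 \<and>
      (\<forall>x. (\<forall>i. x i \<in> carrier A) \<longrightarrow> eval_free A x f = \<zero>\<^bsub>A\<^esub>))"


section \<open>Algebras given by generators and relations\<close>

definition rel_ideal ::
    "('v, 'k::field) free_algebra set \<Rightarrow> ('v, 'k) free_algebra set"
  where "rel_ideal S = genideal ring_of_type_algebra S"

text \<open>The quotient of the free algebra by the two-sided ideal generated by \<open>S\<close>, as an algebra
  over the ground field; a scalar acts as left multiplication by its image in the quotient.\<close>

definition presented_algebra ::
    "('v, 'k::field) free_algebra set \<Rightarrow> ('k, ('v, 'k) free_algebra set) module"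
  where "presented_algebra S =
    (let F = ring_of_type_algebra; I = rel_ideal S; Q = F Quot I in
      \<lparr>carrier = carrier Q, monoid.mult = monoid.mult Q, one = \<one>\<^bsub>Q\<^esub>,
       ring.zero = \<zero>\<^bsub>Q\<^esub>, add = add Q,
       module.smult = (\<lambda>c a. (I +>\<^bsub>F\<^esub> scalar c) \<otimes>\<^bsub>Q\<^esub> a)\<rparr>)"

lemma ring_free_algebra:
  "ring (ring_of_type_algebra :: ('v, 'k::field) free_algebra ring)"
proof -
  have "\<exists>y. x + y = 0" for x :: "('v, 'k) free_algebra"
    by (rule exI[of _ "- x"]) simp
  thus ?thesis
    unfolding ring_of_type_algebra_def using add.right_inverse
    by unfold_locales (auto simp: algebra_simps Units_def)
qed

lemma scalar_commute: "scalar c * p = p * scalar c" for c :: "'k::field"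
proof (rule poly_mapping_eqI)
  fix w
  have "Poly_Mapping.lookup (scalar c * p) w = c * Poly_Mapping.lookup p w"
    by (simp add: scalar_def lookup_mult lookup_single when_mult)
  moreover have "Poly_Mapping.lookup (p * scalar c) w = Poly_Mapping.lookup p w * c"
  proof -
    have "(\<Sum>q. (c when 0 = q) when w = l + q) = (c when l = w)" for l
    proof -
      have "(\<lambda>q. (c when 0 = q) when w = l + q) = (\<lambda>q. (c when l = w) when q = 0)"
        by (auto simp: when_def)
      thus ?thesis by (simp only: Sum_any_when_equal)
    qed
    thus ?thesis
      by (simp add: scalar_def lookup_mult lookup_single mult_when)
  qed
  ultimately show "Poly_Mapping.lookup (scalar c * p) w = Poly_Mapping.lookup (p * scalar c) w"
    by (simp add: mult.commute)
qed

lemma assoc_algebra_presented: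
  fixes S :: "('v, 'k::field) free_algebra set"
  shows "assoc_algebra (ring_of_type_algebra :: 'k ring) (presented_algebra S)"
proof -
  let ?K = "ring_of_type_algebra :: 'k ring"
  define F where "F = (ring_of_type_algebra :: ('v, 'k) free_algebra ring)"
  define I where "I = rel_ideal S"
  define Q where "Q = F Quot I"
  define A where "A = presented_algebra S"
  define u where "u c = I +>\<^bsub>F\<^esub> scalar c" for c
  have F: "carrier F = UNIV" "x \<otimes>\<^bsub>F\<^esub> y = x * y" "x \<oplus>\<^bsub>F\<^esub> y = x + y" "\<one>\<^bsub>F\<^esub> = 1" for x y
    by (simp_all add: F_def ring_of_type_algebra_def)
  have K: "carrier ?K = UNIV" "x \<otimes>\<^bsub>?K\<^esub> y = x * y" "x \<oplus>\<^bsub>?K\<^esub> y = x + y" "\<one>\<^bsub>?K\<^esub> = 1" for x y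
    by (simp_all add: ring_of_type_algebra_def)
  have A: "carrier A = carrier Q" "monoid.mult A = monoid.mult Q" "\<one>\<^bsub>A\<^esub> = \<one>\<^bsub>Q\<^esub>"
    "\<zero>\<^bsub>A\<^esub> = \<zero>\<^bsub>Q\<^esub>" "add A = add Q" "module.smult A c a = u c \<otimes>\<^bsub>Q\<^esub> a" for c a
    by (simp_all add: A_def presented_algebra_def Let_def Q_def F_def I_def u_def)
  interpret F: ring F unfolding F_def by (rule ring_free_algebra)
  interpret I: ideal I F
    unfolding I_def rel_ideal_def F_def[symmetric] by (rule F.genideal_ideal) (simp add: F)
  interpret Q: ring Q unfolding Q_def by (rule I.quotient_is_ring)
  interpret pi: ring_hom_ring F Q "(+>\<^bsub>F\<^esub>) I" unfolding Q_def by (rule I.rcos_ring_hom_ring)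
  have u_closed [simp]: "u c \<in> carrier Q" for c
    unfolding u_def by (rule pi.hom_closed) (simp add: F)
  have u_add: "u (c + d) = u c \<oplus>\<^bsub>Q\<^esub> u d" for c d
  proof -
    have "scalar (c + d) = scalar c \<oplus>\<^bsub>F\<^esub> scalar d"
      by (simp add: scalar_def F single_add)
    thus ?thesis unfolding u_def by (metis F(1) UNIV_I pi.hom_add)
  qed
  have u_mult: "u (c * d) = u c \<otimes>\<^bsub>Q\<^esub> u d" for c d
  proof -
    have "scalar (c * d) = scalar c \<otimes>\<^bsub>F\<^esub> scalar d"
      by (simp add: scalar_def F mult_single)
    thus ?thesis unfolding u_def by (metis F(1) UNIV_I pi.hom_mult)
  qed
  have u_one: "u 1 = \<one>\<^bsub>Q\<^esub>"
  proof -
    have "scalar 1 = \<one>\<^bsub>F\<^esub>" by (simp add: scalar_def F)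
    thus ?thesis by (simp add: u_def)
  qed
  have u_central: "a \<otimes>\<^bsub>Q\<^esub> u c = u c \<otimes>\<^bsub>Q\<^esub> a" if "a \<in> carrier Q" for c a
  proof -
    from that obtain p where p: "a = I +>\<^bsub>F\<^esub> p"
      unfolding Q_def FactRing_def A_RCOSETS_def' a_r_coset_def by (auto simp: r_coset_def)
    have "a \<otimes>\<^bsub>Q\<^esub> u c = I +>\<^bsub>F\<^esub> (p * scalar c)"
      unfolding p u_def F(2)[symmetric] by (rule pi.hom_mult[symmetric]) (simp_all add: F)
    also have "\<dots> = I +>\<^bsub>F\<^esub> (scalar c * p)"
      by (simp add: scalar_commute)
    also have "\<dots> = u c \<otimes>\<^bsub>Q\<^esub> a"
      unfolding p u_def F(2)[symmetric] by (rule pi.hom_mult) (simp_all add: F)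
    finally show ?thesis .
  qed
  have abA: "abelian_group A"
  proof (rule abelian_groupI)
    show "\<exists>y\<in>carrier A. y \<oplus>\<^bsub>A\<^esub> x = \<zero>\<^bsub>A\<^esub>" if "x \<in> carrier A" for x
      using that Q.l_neg Q.a_inv_closed by (auto simp: A)
  qed (simp_all add: A Q.add.m_ac)
  have monA: "Group.monoid A"
    by (rule monoidI) (simp_all add: A Q.m_assoc)
  have ringA: "ring A"
    by (rule ringI[OF abA monA]) (simp_all add: A Q.l_distr Q.r_distr)
  have modA: "module ?K A"
    by (rule moduleI[OF cring_from_type_algebra abA])
       (simp_all add: A K u_add u_mult u_one Q.l_distr Q.r_distr Q.m_assoc)
  have left: "u c \<otimes>\<^bsub>Q\<^esub> x \<otimes>\<^bsub>Q\<^esub> y = u c \<otimes>\<^bsub>Q\<^esub> (x \<otimes>\<^bsub>Q\<^esub> y)"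
    if "x \<in> carrier Q" "y \<in> carrier Q" for c x y
    using that by (simp add: Q.m_assoc)
  have right: "x \<otimes>\<^bsub>Q\<^esub> (u c \<otimes>\<^bsub>Q\<^esub> y) = u c \<otimes>\<^bsub>Q\<^esub> (x \<otimes>\<^bsub>Q\<^esub> y)"
    if "x \<in> carrier Q" "y \<in> carrier Q" for c x y
  proof -
    have "x \<otimes>\<^bsub>Q\<^esub> (u c \<otimes>\<^bsub>Q\<^esub> y) = (x \<otimes>\<^bsub>Q\<^esub> u c) \<otimes>\<^bsub>Q\<^esub> y"
      using that by (simp add: Q.m_assoc)
    also have "\<dots> = (u c \<otimes>\<^bsub>Q\<^esub> x) \<otimes>\<^bsub>Q\<^esub> y"
      by (simp only: u_central[OF that(1)])
    also have "\<dots> = u c \<otimes>\<^bsub>Q\<^esub> (x \<otimes>\<^bsub>Q\<^esub> y)"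
      by (rule left[OF that])
    finally show ?thesis .
  qed
  show ?thesis
    unfolding A_def[symmetric]
    by (rule assoc_algebra.intro[OF modA ringA], rule assoc_algebra_axioms.intro)
       (simp_all only: A left right)
qed


section \<open>The algebra of type B2\<close>

datatype B2_gen = E1 | E2

definition B2_relations :: "complex \<Rightarrow> complex \<Rightarrow> (B2_gen, complex) free_algebra set"
  where "B2_relations r s =
    (let e1 = gen E1; e2 = gen E2 in
      {e1^2 * e2 - scalar (r^2 + s^2) * (e1 * e2 * e1) + scalar (r^2 * s^2) * (e2 * e1^2),
       e1 * e2^3 - scalar (r^2 + r*s + s^2) * (e2 * e1 * e2^2)
         + scalar (r * s * (r^2 + r*s + s^2)) * (e2^2 * e1 * e2)
         - scalar (r^3 * s^3) * (e2^3 * e1)})"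

definition U_plus_B2 ::
    "complex \<Rightarrow> complex \<Rightarrow> (complex, (B2_gen, complex) free_algebra set) module"
  where "U_plus_B2 r s = presented_algebra (B2_relations r s)"

definition root_of_unity :: "complex \<Rightarrow> bool"
  where "root_of_unity z \<longleftrightarrow> (\<exists>n::nat. n > 0 \<and> z ^ n = 1)"

end

theory Submission
  imports Defs "HOL-Combinatorics.Permutations"
begin

text \<open>Put \<open>e3 = e1 e2 - r\<^sup>2 e2 e1\<close> and \<open>e4 = e3 e2 - r s e2 e3\<close>. The relations make
  \<open>e1, e3, e4, e2\<close> commute pairwise up to scalars and lower terms, so the ordered monomials
  \<open>e2\<^sup>a e4\<^sup>b e3\<^sup>c e1\<^sup>d\<close> span the algebra. If \<open>r\<^sup>N = s\<^sup>N = 1\<close>, the lower terms in the commutators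
  of the \<open>N\<close>-th powers carry divided differences of \<open>t \<mapsto> t\<^sup>N\<close> at \<open>N\<close>-th roots of unity and vanish.
  Hence these powers are central, the algebra is finitely generated over its centre, and a standard
  identity holds.

  Conversely, killing \<open>e3\<close> leaves the quantum plane \<open>e1 e2 = r\<^sup>2 e2 e1\<close>, which acts on sequences
  by a shift \<open>e1\<close> and a diagonal operator \<open>e2\<close> with entries \<open>(r\<^sup>2)\<^sup>n\<close>. If \<open>r\<close> is not a root of
  unity these entries are distinct, so polynomials in \<open>e2\<close> can be chosen to vanish on some of them;
  substituting such polynomials times \<open>e1\<close> isolates any single monomial of a given polynomial.
  The relations are symmetric in \<open>r\<close> and \<open>s\<close>.\<close>

section \<open>Congruence modulo an ideal and finite generation over the centre\<close>

text \<open>The quotient depends on \<open>r\<close> and \<open>s\<close> and so cannot be a type; its equations are congruences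
  modulo the ideal inside the type of the free algebra.\<close>

locale algebra_ideal = vector_space scale
  for scale :: "'k::field \<Rightarrow> 'a::ring_1 \<Rightarrow> 'a" (infixr \<open>\<bullet>\<close> 75) +
  fixes I :: "'a set"
  assumes scale_mult_left: "(c \<bullet> x) * y = c \<bullet> (x * y)"
    and scale_mult_right: "x * (c \<bullet> y) = c \<bullet> (x * y)"
    and zero_mem: "0 \<in> I"
    and add_mem: "x \<in> I \<Longrightarrow> y \<in> I \<Longrightarrow> x + y \<in> I"
    and mult_left_mem: "x \<in> I \<Longrightarrow> a * x \<in> I"
    and mult_right_mem: "x \<in> I \<Longrightarrow> x * a \<in> I"
begin

lemma scale_mem: "x \<in> I \<Longrightarrow> c \<bullet> x \<in> I"
  using mult_left_mem[of x "c \<bullet> 1"] by (simp add: scale_mult_left)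

lemma uminus_mem: "x \<in> I \<Longrightarrow> - x \<in> I"
  using mult_left_mem[of x "- 1"] by simp

lemma diff_mem: "x \<in> I \<Longrightarrow> y \<in> I \<Longrightarrow> x - y \<in> I"
  using add_mem[OF _ uminus_mem, of x y] by simp

lemma sum_mem: "(\<And>i. i \<in> A \<Longrightarrow> f i \<in> I) \<Longrightarrow> sum f A \<in> I"
  by (induction A rule: infinite_finite_induct) (auto intro: zero_mem add_mem)

definition eqv :: "'a \<Rightarrow> 'a \<Rightarrow> bool" (infix \<open>\<approx>\<close> 50)
  where "a \<approx> b \<longleftrightarrow> a - b \<in> I"

lemma eqv_refl [simp]: "a \<approx> a"
  by (simp add: eqv_def zero_mem)

lemma eqv_sym: "a \<approx> b \<Longrightarrow> b \<approx> a"
  unfolding eqv_def using uminus_mem[of "a - b"] by simp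

lemma eqv_trans [trans]: "a \<approx> b \<Longrightarrow> b \<approx> c \<Longrightarrow> a \<approx> c"
  unfolding eqv_def using add_mem[of "a - b" "b - c"] by simp

lemma eqv_add: "a \<approx> b \<Longrightarrow> c \<approx> d \<Longrightarrow> a + c \<approx> b + d"
  unfolding eqv_def using add_mem[of "a - b" "c - d"] by (simp add: algebra_simps)

lemma eqv_mult_left: "a \<approx> b \<Longrightarrow> c * a \<approx> c * b"
  unfolding eqv_def using mult_left_mem[of "a - b" c] by (simp add: algebra_simps)

lemma eqv_mult_right: "a \<approx> b \<Longrightarrow> a * c \<approx> b * c"
  unfolding eqv_def using mult_right_mem[of "a - b" c] by (simp add: algebra_simps)

lemma eqv_scale: "a \<approx> b \<Longrightarrow> c \<bullet> a \<approx> c \<bullet> b"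
  unfolding eqv_def using scale_mem[of "a - b" c] by (simp add: scale_right_diff_distrib)

lemma eqv_sum: "(\<And>i. i \<in> A \<Longrightarrow> f i \<approx> g i) \<Longrightarrow> sum f A \<approx> sum g A"
  unfolding eqv_def using sum_mem[of A "\<lambda>i. f i - g i"] by (simp add: sum_subtractf)

lemma eqv_mem: "a \<approx> b \<Longrightarrow> b \<in> I \<Longrightarrow> a \<in> I"
  unfolding eqv_def using add_mem[of "a - b" b] by simp

section \<open>Elements central modulo the ideal, and spans over them\<close>

definition central :: "'a \<Rightarrow> bool"
  where "central z \<longleftrightarrow> (\<forall>a. z * a \<approx> a * z)"

lemma centralD: "central z \<Longrightarrow> z * a \<approx> a * z"
  by (simp add: central_def)

lemma central_scalar: "central (c \<bullet> 1)"
  by (simp add: central_def scale_mult_left scale_mult_right)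

text \<open>The preimage of the submodule that \<open>B\<close> spans over the centre of the
  quotient. Closure rules replace explicit linear combinations; scalars are covered by
  \<open>mult\<close> because they are central.\<close>

inductive_set zspan :: "'a set \<Rightarrow> 'a set" for B where
  base: "b \<in> B \<Longrightarrow> b \<in> zspan B"
| zero: "0 \<in> zspan B"
| add: "a \<in> zspan B \<Longrightarrow> b \<in> zspan B \<Longrightarrow> a + b \<in> zspan B"
| mult: "central z \<Longrightarrow> a \<in> zspan B \<Longrightarrow> z * a \<in> zspan B"
| eqv: "a \<in> zspan B \<Longrightarrow> b \<approx> a \<Longrightarrow> b \<in> zspan B"

lemma zspan_scale: "a \<in> zspan B \<Longrightarrow> c \<bullet> a \<in> zspan B"
  using zspan.mult[OF central_scalar] by (simp add: scale_mult_left)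

text \<open>Central coefficients can be moved past \<open>g\<close>, so left multiplication by
  \<open>g\<close> only has to be tested on \<open>B\<close>.\<close>

lemma zspan_mult_closed:
  assumes "a \<in> zspan B" "\<And>b. b \<in> B \<Longrightarrow> g * b \<in> zspan B'"
  shows "g * a \<in> zspan B'"
  using assms(1)
proof induction
  case (mult z a)
  have "g * (z * a) \<approx> z * (g * a)"
    using eqv_mult_right[OF eqv_sym[OF centralD[OF mult(1), of g]], of a] by (simp add: mult.assoc)
  thus ?case using zspan.mult[OF mult(1,3)] zspan.eqv by blast
next
  case (eqv a b)
  thus ?case using zspan.eqv eqv_mult_left by blast
qed (auto simp: assms(2) distrib_left intro: zspan.zero zspan.add)

lemma zspan_mono: "B \<subseteq> B' \<Longrightarrow> a \<in> zspan B \<Longrightarrow> a \<in> zspan B'"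
  using zspan_mult_closed[of a B 1 B'] by (auto intro: zspan.base)

text \<open>The elements stable for \<open>B\<close> form a unital subalgebra. Once it contains
  algebra generators and \<open>1\<close> lies in \<open>B\<close>, the span of \<open>B\<close> is
  everything.\<close>

definition stable :: "'a \<Rightarrow> 'a set \<Rightarrow> bool"
  where "stable g B \<longleftrightarrow> (\<forall>a \<in> zspan B. g * a \<in> zspan B)"

lemma stableD: "stable g B \<Longrightarrow> a \<in> zspan B \<Longrightarrow> g * a \<in> zspan B"
  by (simp add: stable_def)

lemma stable_scale: "stable g B \<Longrightarrow> stable (c \<bullet> g) B"
  by (simp add: stable_def scale_mult_left zspan_scale)

lemma stable_add: "stable g B \<Longrightarrow> stable h B \<Longrightarrow> stable (g + h) B"
  by (simp add: stable_def distrib_right zspan.add)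

lemma stable_mult: "stable g B \<Longrightarrow> stable h B \<Longrightarrow> stable (g * h) B"
  by (simp add: stable_def mult.assoc)

lemma stable_zero: "stable 0 B"
  by (simp add: stable_def zspan.zero)

lemma stable_one: "stable 1 B"
  by (simp add: stable_def)

text \<open>If \<open>x ^ N\<close> is central, this is enough to generate all \<open>x ^ i * b\<close> over the centre.\<close>

definition power_ext :: "nat \<Rightarrow> 'a \<Rightarrow> 'a set \<Rightarrow> 'a set"
  where "power_ext N x B = (\<lambda>(i, b). x ^ i * b) ` ({..<N} \<times> B)"

lemma finite_power_ext: "finite B \<Longrightarrow> finite (power_ext N x B)"
  by (simp add: power_ext_def)

lemma power_ext_mono: "N > 0 \<Longrightarrow> B \<subseteq> power_ext N x B"
  by (force simp: power_ext_def)

text \<open>Exponents from \<open>N\<close> on are lowered by splitting off the central factor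
  \<open>x ^ N\<close>.\<close>

lemma power_mult_mem_power_ext:
  assumes "N > 0" "central (x ^ N)" "a \<in> zspan B"
  shows "x ^ i * a \<in> zspan (power_ext N x B)"
proof (rule zspan_mult_closed[OF assms(3)])
  fix b assume b: "b \<in> B"
  show "x ^ i * b \<in> zspan (power_ext N x B)"
  proof (induction i rule: less_induct)
    case (less i)
    show ?case
    proof (cases "i < N")
      case True
      thus ?thesis using b by (intro zspan.base) (force simp: power_ext_def)
    next
      case False
      hence "x ^ i * b = x ^ N * (x ^ (i - N) * b)"
        by (simp add: mult.assoc[symmetric] power_add[symmetric])
      thus ?thesis using less[of "i - N"] False assms by (auto intro: zspan.mult)
    qed
  qed
qed

lemma stable_power_ext_self:
  assumes "N > 0" "central (x ^ N)"
  shows "stable x (power_ext N x B)"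
  unfolding stable_def
proof
  fix a assume "a \<in> zspan (power_ext N x B)"
  thus "x * a \<in> zspan (power_ext N x B)"
  proof (rule zspan_mult_closed)
    fix b' assume "b' \<in> power_ext N x B"
    then obtain i b where "b' = x ^ i * b" "b \<in> B" by (auto simp: power_ext_def)
    thus "x * b' \<in> zspan (power_ext N x B)"
      using power_mult_mem_power_ext[OF assms, of b B "Suc i"] by (simp add: zspan.base mult.assoc)
  qed
qed

text \<open>Moving \<open>g\<close> past one factor \<open>x\<close> leaves a remainder
  \<open>h\<close>. This \<open>h\<close> acts on elements \<open>x ^ i * b\<close>, so it must be
  stable for the extended set, whereas \<open>g\<close> meets only \<open>B\<close> after passing
  all factors.\<close>

lemma stable_power_ext:
  assumes N: "N > 0" "central (x ^ N)"
    and gx: "g * x \<approx> c \<bullet> (x * g) + h"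
    and g: "stable g B" and h: "stable h (power_ext N x B)"
  shows "stable g (power_ext N x B)"
  unfolding stable_def
proof
  fix a assume "a \<in> zspan (power_ext N x B)"
  thus "g * a \<in> zspan (power_ext N x B)"
  proof (rule zspan_mult_closed)
    fix b' assume "b' \<in> power_ext N x B"
    then obtain i b where b: "b' = x ^ i * b" "b \<in> B" by (auto simp: power_ext_def)
    have "g * (x ^ i * b) \<in> zspan (power_ext N x B)"
    proof (induction i)
      case 0
      show ?case using b g zspan_mono[OF power_ext_mono[OF N(1)]] zspan.base
        by (auto simp: stable_def)
    next
      case (Suc i)
      have 1: "g * (x ^ Suc i * b) \<approx> c \<bullet> (x * (g * (x ^ i * b))) + h * (x ^ i * b)"
        using eqv_mult_right[OF gx, of "x ^ i * b"]
        by (simp add: mult.assoc scale_mult_left distrib_right)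
      have 2: "x * (g * (x ^ i * b)) \<in> zspan (power_ext N x B)"
        using Suc stable_power_ext_self[OF N] by (auto simp: stable_def)
      have 3: "h * (x ^ i * b) \<in> zspan (power_ext N x B)"
        by (rule stableD[OF h]) (rule power_mult_mem_power_ext[OF N zspan.base[OF b(2)]])
      show ?case using 1 zspan.add[OF zspan_scale[OF 2] 3] zspan.eqv by blast
    qed
    thus "g * b' \<in> zspan (power_ext N x B)" by (simp add: b)
  qed
qed

section \<open>Powers of elements that commute up to a scalar and a remainder\<close>

text \<open>The coefficient of the remainder is the sum of \<open>p ^ i * t ^ j\<close> over
  \<open>i + j = n\<close>, a divided difference. Written as a quotient it visibly vanishes when
  \<open>p ^ Suc n = t ^ Suc n\<close>.\<close>

lemma power_Suc_skew_commute:
  assumes xy: "x * y \<approx> p \<bullet> (y * x) + z" and xz: "x * z \<approx> t \<bullet> (z * x)" and "p \<noteq> t"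
  shows "x ^ Suc n * y \<approx> p ^ Suc n \<bullet> (y * x ^ Suc n)
           + ((p ^ Suc n - t ^ Suc n) / (p - t)) \<bullet> (z * x ^ n)"
proof (induction n)
  case 0
  show ?case using xy \<open>p \<noteq> t\<close> by simp
next
  case (Suc n)
  define c where "c = (p ^ Suc n - t ^ Suc n) / (p - t)"
  have c: "p ^ Suc n + t * c = (p ^ Suc (Suc n) - t ^ Suc (Suc n)) / (p - t)"
    using \<open>p \<noteq> t\<close> by (simp add: c_def field_simps)
  have "x ^ Suc (Suc n) * y \<approx> p ^ Suc n \<bullet> ((x * y) * x ^ Suc n) + c \<bullet> ((x * z) * x ^ n)"
    using eqv_mult_left[OF Suc, of x, folded c_def]
    by (simp add: distrib_left scale_mult_right mult.assoc)
  also have "\<dots> \<approx> p ^ Suc n \<bullet> ((p \<bullet> (y * x) + z) * x ^ Suc n) + c \<bullet> ((t \<bullet> (z * x)) * x ^ n)"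
    by (intro eqv_add eqv_scale eqv_mult_right xy xz)
  also have "\<dots> = p ^ Suc (Suc n) \<bullet> (y * x ^ Suc (Suc n)) + (p ^ Suc n + t * c) \<bullet> (z * x ^ Suc n)"
    by (simp add: distrib_right scale_mult_left scale_right_distrib scale_left_distrib
        mult.assoc mult.commute add.assoc)
  finally show ?case unfolding c .
qed

lemma power_commute:
  assumes "x * y \<approx> p \<bullet> (y * x) + z" "x * z \<approx> t \<bullet> (z * x)" "p \<noteq> t"
    and "p ^ N = 1" "t ^ N = 1" "N > 0"
  shows "x ^ N * y \<approx> y * x ^ N"
  using power_Suc_skew_commute[OF assms(1-3), of "N - 1"] assms(4-6) by simp

lemma power_commute_skew:
  assumes "x * y \<approx> p \<bullet> (y * x)" "p ^ N = 1"
  shows "x ^ N * y \<approx> y * x ^ N"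
proof -
  have "x ^ n * y \<approx> p ^ n \<bullet> (y * x ^ n)" for n
  proof (induction n)
    case (Suc n)
    have "x ^ Suc n * y \<approx> p ^ n \<bullet> ((x * y) * x ^ n)"
      using eqv_mult_left[OF Suc, of x] by (simp add: scale_mult_right mult.assoc)
    also have "\<dots> \<approx> p ^ n \<bullet> ((p \<bullet> (y * x)) * x ^ n)"
      by (intro eqv_scale eqv_mult_right assms)
    finally show ?case by (simp add: scale_mult_left mult.assoc mult.commute)
  qed simp
  from this[of N] show ?thesis by (simp add: assms)
qed

end

section \<open>The standard identity\<close>

text \<open>The standard polynomial of degree \<open>m\<close>, evaluated at
  \<open>x\<close>.\<close>

definition standard_sum :: "nat \<Rightarrow> (nat \<Rightarrow> 'a::ring_1) \<Rightarrow> 'a"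
  where "standard_sum m x =
    (\<Sum>\<sigma> | \<sigma> permutes {..<m}. of_int (sign \<sigma>) * prod_list (map (x \<circ> \<sigma>) [0..<m]))"

text \<open>Composing with the transposition permutes the summands, leaves \<open>x\<close>
  unchanged and flips every sign. The conclusion stops short of zero because characteristic two is
  still allowed.\<close>

lemma standard_sum_transpose:
  assumes "i < m" "j < m" "i \<noteq> j" "x i = x j"
  shows "standard_sum m x = - standard_sum m x"
proof -
  define \<tau> where "\<tau> = transpose i j"
  have \<tau>: "\<tau> permutes {..<m}" unfolding \<tau>_def using assms by (intro permutes_swap_id) auto
  have x\<tau>: "x \<circ> \<tau> = x" using assms by (auto simp: \<tau>_def transpose_def fun_eq_iff)
  have "standard_sum m x =
      (\<Sum>\<sigma> | \<sigma> permutes {..<m}. of_int (sign (\<tau> \<circ> \<sigma>)) * prod_list (map (x \<circ> (\<tau> \<circ> \<sigma>)) [0..<m]))"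
    unfolding standard_sum_def
    by (rule setum_permutations_compose_left[OF \<tau>])
  also have "\<dots> = (\<Sum>\<sigma> | \<sigma> permutes {..<m}. - (of_int (sign \<sigma>) * prod_list (map (x \<circ> \<sigma>) [0..<m])))"
  proof (intro sum.cong refl)
    fix \<sigma> assume "\<sigma> \<in> {\<sigma>. \<sigma> permutes {..<m}}"
    hence "permutation \<sigma>" by (auto intro: permutes_imp_permutation)
    hence "sign (\<tau> \<circ> \<sigma>) = - sign \<sigma>"
      using assms by (simp add: sign_compose \<tau>_def permutation_swap_id sign_swap_id)
    moreover have "x \<circ> (\<tau> \<circ> \<sigma>) = x \<circ> \<sigma>" by (simp add: o_assoc x\<tau>)
    ultimately show "of_int (sign (\<tau> \<circ> \<sigma>)) * prod_list (map (x \<circ> (\<tau> \<circ> \<sigma>)) [0..<m])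
        = - (of_int (sign \<sigma>) * prod_list (map (x \<circ> \<sigma>) [0..<m]))" by simp
  qed
  also have "\<dots> = - standard_sum m x"
    by (simp add: standard_sum_def sum_negf)
  finally show ?thesis .
qed

text \<open>The index \<open>k\<close> occurs at exactly one position, its preimage under the
  permutation, so the product is linear in the entry there.\<close>

lemma prod_list_fun_upd_perm:
  assumes "\<sigma> permutes {..<m}" "k < m"
  shows "\<exists>L R. \<forall>a::'a::monoid_mult. prod_list (map (x(k := a) \<circ> \<sigma>) [0..<m]) = L * a * R"
proof -
  define j where "j = inv_into UNIV \<sigma> k"
  have j: "\<sigma> j = k" by (simp add: j_def permutes_inverses[OF assms(1)])
  have "j < m" using j assms permutes_in_image[OF assms(1), of j] by simp
  hence split: "[0..<m] = [0..<j] @ j # [Suc j..<m]"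
    using upt_add_eq_append[of 0 j "m - j"] upt_conv_Cons[of j m] by simp
  have ne: "\<sigma> l \<noteq> k" if "l \<noteq> j" for l
    using that j permutes_inj[OF assms(1)] by (auto dest: injD)
  have "map (x(k := a) \<circ> \<sigma>) [0..<j] = map (x \<circ> \<sigma>) [0..<j]"
    "map (x(k := a) \<circ> \<sigma>) [Suc j..<m] = map (x \<circ> \<sigma>) [Suc j..<m]" for a
    using ne by auto
  hence "\<forall>a. prod_list (map (x(k := a) \<circ> \<sigma>) [0..<m])
      = prod_list (map (x \<circ> \<sigma>) [0..<j]) * a * prod_list (map (x \<circ> \<sigma>) [Suc j..<m])"
    using j unfolding split by (simp add: mult.assoc del: map_eq_conv)
  thus ?thesis by blast
qed

context algebra_ideal
begin

text \<open>Multilinearity over the centre modulo the ideal, which lets arguments be replaced by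
  elements of a spanning set.\<close>

lemma standard_sum_fun_upd:
  assumes k: "k < m"
  shows standard_sum_upd_zero: "standard_sum m (x(k := 0)) = 0"
    and standard_sum_upd_add:
      "standard_sum m (x(k := a + b)) = standard_sum m (x(k := a)) + standard_sum m (x(k := b))"
    and standard_sum_upd_mult:
      "central z \<Longrightarrow> standard_sum m (x(k := z * a)) \<approx> z * standard_sum m (x(k := a))"
    and standard_sum_upd_eqv:
      "a \<approx> b \<Longrightarrow> standard_sum m (x(k := a)) \<approx> standard_sum m (x(k := b))"
proof -
  \<comment> \<open>The outer factors are fixed once for each permutation, so that all four claims
    share the formula \<open>eq\<close>.\<close>
  have "\<forall>\<sigma>. \<exists>L R. \<sigma> permutes {..<m} \<longrightarrow>
      (\<forall>a. prod_list (map (x(k := a) \<circ> \<sigma>) [0..<m]) = L * a * R)"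
    using prod_list_fun_upd_perm[OF _ k] by blast
  then obtain L R where LR: "\<And>\<sigma> a. \<sigma> permutes {..<m} \<Longrightarrow>
      prod_list (map (x(k := a) \<circ> \<sigma>) [0..<m]) = L \<sigma> * a * R \<sigma>"
    by metis
  have eq: "standard_sum m (x(k := a)) =
      (\<Sum>\<sigma> | \<sigma> permutes {..<m}. of_int (sign \<sigma>) * (L \<sigma> * a * R \<sigma>))" for a
    unfolding standard_sum_def by (intro sum.cong refl) (simp only: LR mem_Collect_eq)
  show "standard_sum m (x(k := 0)) = 0"
    unfolding eq by simp
  show "standard_sum m (x(k := a + b)) = standard_sum m (x(k := a)) + standard_sum m (x(k := b))"
    unfolding eq by (simp add: algebra_simps sum.distrib)
  show "standard_sum m (x(k := z * a)) \<approx> z * standard_sum m (x(k := a))" if z: "central z"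
    unfolding eq sum_distrib_left
  proof (rule eqv_sum)
    fix \<sigma>
    have "of_int (sign \<sigma>) * L \<sigma> * z * (a * R \<sigma>) \<approx> z * (of_int (sign \<sigma>) * L \<sigma>) * (a * R \<sigma>)"
      by (rule eqv_mult_right[OF eqv_sym[OF centralD[OF z]]])
    thus "of_int (sign \<sigma>) * (L \<sigma> * (z * a) * R \<sigma>) \<approx> z * (of_int (sign \<sigma>) * (L \<sigma> * a * R \<sigma>))"
      by (simp add: mult.assoc)
  qed
  show "standard_sum m (x(k := a)) \<approx> standard_sum m (x(k := b))" if "a \<approx> b"
    unfolding eq by (intro eqv_sum eqv_mult_left eqv_mult_right that)
qed

text \<open>Multilinearity reduces to arguments in \<open>B\<close>; as there are more arguments
  than elements of \<open>B\<close>, two of them agree.\<close>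

lemma standard_sum_mem:
  assumes two: "(2::'k) \<noteq> 0" and B: "finite B" "card B < m" and all: "\<And>a. a \<in> zspan B"
  shows "standard_sum m x \<in> I"
proof -
  \<comment> \<open>The first \<open>k\<close> arguments are still arbitrary, the later ones already
    lie in \<open>B\<close>.\<close>
  have "standard_sum m x \<in> I" if "k \<le> m" "\<And>i. k \<le> i \<Longrightarrow> i < m \<Longrightarrow> x i \<in> B" for k x
    using that
  proof (induction k arbitrary: x)
    case 0
    have "\<not> inj_on x {..<m}"
      using card_inj_on_le[of x "{..<m}" B] 0 B by (auto simp: image_subset_iff)
    then obtain i j where "i < m" "j < m" "i \<noteq> j" "x i = x j"
      by (auto simp: inj_on_def)
    hence "standard_sum m x = - standard_sum m x"
      by (rule standard_sum_transpose)
    hence "standard_sum m x + standard_sum m x = 0"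
      by (simp add: eq_neg_iff_add_eq_0)
    hence "(1 + 1) \<bullet> standard_sum m x = 0"
      by (simp only: scale_left_distrib scale_one)
    thus ?case using two by (simp add: zero_mem)
  next
    case (Suc k)
    hence k: "k < m" by simp
    \<comment> \<open>Argument \<open>k\<close> runs through the span by induction on its generation
      from \<open>B\<close>.\<close>
    have "standard_sum m (x(k := a)) \<in> I" for a
      using all[of a]
    proof induction
      case (base b)
      show ?case using Suc.prems base by (intro Suc.IH) (auto simp del: Suc_le_eq)
    next
      case (mult z a)
      show ?case
        by (rule eqv_mem[OF standard_sum_upd_mult[OF k mult(1)]]) (rule mult_left_mem[OF mult(3)])
    next
      case (eqv a b)
      show ?case by (rule eqv_mem[OF standard_sum_upd_eqv[OF k eqv(2)] eqv(3)])
    qed (simp_all only: standard_sum_upd_zero[OF k] standard_sum_upd_add[OF k] zero_mem add_mem)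
    from this[of "x k"] show ?case by simp
  qed
  from this[of m] show ?thesis by simp
qed

end

section \<open>The relations of type B2\<close>

context algebra_ideal
begin

text \<open>Moving \<open>y\<close> past \<open>x ^ n\<close> leaves multiples of \<open>z\<close>
  and \<open>w\<close>, whose coefficients are the first and second divided differences of the
  \<open>n\<close>-th power function at \<open>p, u\<close> and at \<open>p, u, t\<close>. Both
  vanish for \<open>n = N\<close>.\<close>

lemma mult_power_commute3:
  assumes yx: "y * x \<approx> p \<bullet> (x * y) + z" and zx: "z * x \<approx> u \<bullet> (x * z) + w"
    and wx: "w * x \<approx> t \<bullet> (x * w)"
    and distinct: "p \<noteq> u" "p \<noteq> t" "u \<noteq> t" and N: "p ^ N = 1" "u ^ N = 1" "t ^ N = 1" "N > 0"
  shows "y * x ^ N \<approx> x ^ N * y"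
proof -
  define \<alpha> where "\<alpha> n = (p ^ n - u ^ n) / (p - u)" for n
  define \<delta> where "\<delta> q n = (q ^ n - t ^ n) / (q - t)" for q n
  define \<beta> where "\<beta> n = (\<delta> p n - \<delta> u n) / (p - u)" for n
  \<comment> \<open>These recurrences record the effect of one more factor \<open>x\<close>.\<close>
  have \<alpha>: "\<alpha> (Suc n) = p ^ n + u * \<alpha> n" for n
    using distinct by (simp add: \<alpha>_def field_simps)
  have \<delta>: "\<delta> q (Suc n) = q ^ n + t * \<delta> q n" if "q \<noteq> t" for q n
    using that by (simp add: \<delta>_def field_simps)
  have \<beta>: "\<beta> (Suc n) = \<alpha> n + t * \<beta> n" for n
    using distinct by (simp add: \<beta>_def \<alpha>_def \<delta> add_divide_distrib diff_divide_distrib right_diff_distrib)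
  have main: "y * x ^ Suc (Suc n) \<approx> p ^ Suc (Suc n) \<bullet> (x ^ Suc (Suc n) * y)
      + \<alpha> (Suc (Suc n)) \<bullet> (x ^ Suc n * z) + \<beta> (Suc (Suc n)) \<bullet> (x ^ n * w)" for n
  proof (induction n)
    case 0
    have "y * x ^ Suc (Suc 0) = (y * x) * x" by (simp add: mult.assoc)
    also have "\<dots> \<approx> (p \<bullet> (x * y) + z) * x" by (rule eqv_mult_right[OF yx])
    also have "\<dots> = p \<bullet> (x * (y * x)) + z * x"
      by (simp add: distrib_right scale_mult_left mult.assoc)
    also have "\<dots> \<approx> p \<bullet> (x * (p \<bullet> (x * y) + z)) + (u \<bullet> (x * z) + w)"
      by (intro eqv_add eqv_scale eqv_mult_left yx zx)
    also have "\<dots> = p ^ Suc (Suc 0) \<bullet> (x ^ Suc (Suc 0) * y) + \<alpha> (Suc (Suc 0)) \<bullet> (x ^ Suc 0 * z)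
        + \<beta> (Suc (Suc 0)) \<bullet> (x ^ 0 * w)"
      unfolding \<alpha> \<beta> by (simp add: \<alpha>_def \<beta>_def \<delta>_def distrib_left scale_mult_right scale_right_distrib
          scale_left_distrib mult.assoc)
    finally show ?case .
  next
    case (Suc n)
    define k where "k = Suc (Suc n)"
    have "y * x ^ Suc k = (y * x ^ k) * x"
      by (simp add: mult.assoc power_commutes)
    also have "\<dots> \<approx> (p ^ k \<bullet> (x ^ k * y) + \<alpha> k \<bullet> (x ^ Suc n * z) + \<beta> k \<bullet> (x ^ n * w)) * x"
      using eqv_mult_right[OF Suc, of x] by (simp add: k_def)
    also have "\<dots> = p ^ k \<bullet> (x ^ k * (y * x)) + \<alpha> k \<bullet> (x ^ Suc n * (z * x)) + \<beta> k \<bullet> (x ^ n * (w * x))"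
      by (simp add: distrib_right scale_mult_left mult.assoc)
    also have "\<dots> \<approx> p ^ k \<bullet> (x ^ k * (p \<bullet> (x * y) + z)) + \<alpha> k \<bullet> (x ^ Suc n * (u \<bullet> (x * z) + w))
        + \<beta> k \<bullet> (x ^ n * (t \<bullet> (x * w)))"
      by (intro eqv_add eqv_scale eqv_mult_left yx zx wx)
    also have "\<dots> = p ^ k \<bullet> (p \<bullet> (x ^ k * x * y) + x ^ k * z) + \<alpha> k \<bullet> (u \<bullet> (x ^ Suc n * x * z) + x ^ Suc n * w)
        + \<beta> k \<bullet> (t \<bullet> (x ^ n * x * w))"
      by (simp only: distrib_left scale_mult_right mult.assoc)
    also have "\<dots> = p ^ Suc k \<bullet> (x ^ Suc k * y) + \<alpha> (Suc k) \<bullet> (x ^ k * z) + \<beta> (Suc k) \<bullet> (x ^ Suc n * w)"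
      unfolding \<alpha> \<beta> k_def
      by (simp add: distrib_left scale_mult_right scale_right_distrib scale_left_distrib
          power_Suc2 mult_ac add_ac del: power_Suc)
    finally show ?case by (simp add: k_def)
  qed
  \<comment> \<open>The formula \<open>main\<close> starts at exponent two; \<open>N = 1\<close>
    would force \<open>p = u = 1\<close>.\<close>
  have "N \<noteq> 1" using N distinct by auto
  hence "Suc (Suc (N - 2)) = N" using N by simp
  with main[of "N - 2"] show ?thesis by (simp add: \<alpha>_def \<beta>_def \<delta>_def N)
qed

text \<open>The first premise says in the form of an induction rule that \<open>G\<close> generates
  the algebra. It is applied to the commutant of \<open>z\<close> modulo the ideal, which is a
  subalgebra.\<close>

lemma centralI_generators:
  assumes "\<And>W. 1 \<in> W \<Longrightarrow> (\<And>x. x \<in> G \<Longrightarrow> x \<in> W) \<Longrightarrow> (\<And>a b. a \<in> W \<Longrightarrow> b \<in> W \<Longrightarrow> a + b \<in> W)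
      \<Longrightarrow> (\<And>a b. a \<in> W \<Longrightarrow> b \<in> W \<Longrightarrow> a * b \<in> W) \<Longrightarrow> (\<And>c a. a \<in> W \<Longrightarrow> c \<bullet> a \<in> W) \<Longrightarrow> W = UNIV"
    and z: "\<And>x. x \<in> G \<Longrightarrow> z * x \<approx> x * z"
  shows "central z"
proof -
  have "{a. z * a \<approx> a * z} = UNIV"
  proof (rule assms(1))
    fix a b assume ab: "a \<in> {a. z * a \<approx> a * z}" "b \<in> {a. z * a \<approx> a * z}"
    show "a + b \<in> {a. z * a \<approx> a * z}"
      using ab eqv_add by (simp add: distrib_left distrib_right)
    have "z * a * b \<approx> a * z * b" using ab by (simp add: eqv_mult_right)
    also have "a * z * b \<approx> a * b * z"
      using ab by (simp add: mult.assoc eqv_mult_left)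
    finally show "a * b \<in> {a. z * a \<approx> a * z}" by (simp add: mult.assoc)
  qed (simp_all add: z scale_mult_left scale_mult_right eqv_scale)
  thus ?thesis by (auto simp: central_def)
qed

end

section \<open>Root vectors and their commutation relations\<close>

locale B2_ideal = algebra_ideal +
  fixes e1 e2 r s
  assumes generators: "\<And>W. 1 \<in> W \<Longrightarrow> (\<And>x. x \<in> {e1, e2} \<Longrightarrow> x \<in> W)
      \<Longrightarrow> (\<And>a b. a \<in> W \<Longrightarrow> b \<in> W \<Longrightarrow> a + b \<in> W)
      \<Longrightarrow> (\<And>a b. a \<in> W \<Longrightarrow> b \<in> W \<Longrightarrow> a * b \<in> W) \<Longrightarrow> (\<And>c a. a \<in> W \<Longrightarrow> scale c a \<in> W) \<Longrightarrow> W = UNIV"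
    and nonzero: "r \<noteq> 0" "s \<noteq> 0" and generic: "r^2 \<noteq> s^2"
    and rel1: "e1^2 * e2 - scale (r^2 + s^2) (e1 * e2 * e1) + scale (r^2 * s^2) (e2 * e1^2) \<in> I"
    and rel2: "e1 * e2^3 - scale (r^2 + r*s + s^2) (e2 * e1 * e2^2)
         + scale (r * s * (r^2 + r*s + s^2)) (e2^2 * e1 * e2) - scale (r^3 * s^3) (e2^3 * e1) \<in> I"
begin

text \<open>The relations are iterated skew commutators: their coefficients come from
  \<open>(t - r^2) (t - s^2)\<close> and \<open>(t - r^2) (t - r s) (t - s^2)\<close>. Stopping one
  factor early gives \<open>e3\<close> and \<open>e4\<close>, the root vectors of the non-simple
  positive roots.\<close>

definition "e3 = e1 * e2 - (r^2) \<bullet> (e2 * e1)"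
definition "e4 = e3 * e2 - (r * s) \<bullet> (e2 * e3)"

lemmas expand = power2_eq_square power3_eq_cube algebra_simps scale_mult_left scale_mult_right
  scale_left_distrib scale_right_distrib scale_left_diff_distrib scale_right_diff_distrib

lemma e1_e2: "e1 * e2 = r^2 \<bullet> (e2 * e1) + e3"
  by (simp add: e3_def)

lemma e3_e2: "e3 * e2 = (r * s) \<bullet> (e2 * e3) + e4"
  by (simp add: e4_def)

lemma e1_e3: "e1 * e3 \<approx> s^2 \<bullet> (e3 * e1)"
  using rel1 by (simp add: eqv_def e3_def expand)

lemma e4_e2: "e4 * e2 \<approx> s^2 \<bullet> (e2 * e4)"
  using rel2 by (simp add: eqv_def e3_def e4_def expand)

text \<open>The skew commutator of \<open>e1_e3\<close> with \<open>e2\<close>. The factor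
  \<open>r^3 * s\<close> is the product of the twists \<open>r^2\<close> and \<open>r * s\<close> of
  \<open>e1\<close> and \<open>e3\<close> past \<open>e2\<close>, so that the terms starting with
  \<open>e2\<close> cancel.\<close>

lemma e1_e4: "e1 * e4 \<approx> (r^2 * s^2) \<bullet> (e4 * e1) + (s * (s - r)) \<bullet> (e3 * e3)"
proof -
  define x where "x = e1 * e3 - s^2 \<bullet> (e3 * e1)"
  have "x \<in> I" using e1_e3 by (simp add: eqv_def x_def)
  hence "x * e2 - (r^3 * s) \<bullet> (e2 * x) \<in> I"
    by (intro diff_mem scale_mem mult_left_mem mult_right_mem)
  also have "x * e2 - (r^3 * s) \<bullet> (e2 * x)
      = e1 * e4 - ((r^2 * s^2) \<bullet> (e4 * e1) + (s * (s - r)) \<bullet> (e3 * e3))"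
    by (simp add: x_def e3_def e4_def expand)
  finally show ?thesis by (simp add: eqv_def)
qed

text \<open>The relations \<open>e1_e4\<close> and \<open>e4_e2\<close> overlap in
  \<open>e1 * e4 * e2\<close>. Comparing the two reductions leaves the claim times
  \<open>r * s\<close>, which is invertible.\<close>

lemma e3_e4: "e3 * e4 \<approx> s^2 \<bullet> (e4 * e3)"
proof -
  define a where "a = e1 * e4 - ((r^2 * s^2) \<bullet> (e4 * e1) + (s * (s - r)) \<bullet> (e3 * e3))"
  define b where "b = e4 * e2 - s^2 \<bullet> (e2 * e4)"
  have "a \<in> I" "b \<in> I" using e1_e4 e4_e2 by (simp_all add: eqv_def a_def b_def)
  hence "(1 / (r * s)) \<bullet> (a * e2 - e1 * b - (r^2 * s^2) \<bullet> (e2 * a) + (r^4 * s^2) \<bullet> (b * e1)) \<in> I"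
    by (intro add_mem diff_mem scale_mem mult_left_mem mult_right_mem)
  also have "a * e2 - e1 * b - (r^2 * s^2) \<bullet> (e2 * a) + (r^4 * s^2) \<bullet> (b * e1)
      = (r * s) \<bullet> (e3 * e4 - s^2 \<bullet> (e4 * e3))"
    by (simp add: a_def b_def e3_def e4_def expand power4_eq_xxxx)
  finally show ?thesis using nonzero by (simp add: eqv_def)
qed


section \<open>Central powers and finite generation\<close>

text \<open>It suffices to commute with \<open>e1\<close> and \<open>e2\<close>. Every remainder
  that arises passes with a twist of its own, and the twists involved are distinct because
  \<open>r^2\<close> and \<open>s^2\<close> are.\<close>

lemma power_central:
  assumes N: "N > 0" "r ^ N = 1" "s ^ N = 1"
  shows "central (e1 ^ N)" "central (e2 ^ N)" "central (e3 ^ N)" "central (e4 ^ N)"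
proof -
  have unity: "(r\<^sup>2) ^ N = 1" "(s\<^sup>2) ^ N = 1" "(r * s) ^ N = 1" "(1 / s\<^sup>2) ^ N = 1"
    "(1 / (r\<^sup>2 * s\<^sup>2)) ^ N = 1" "(1 / (s\<^sup>2 * s\<^sup>2)) ^ N = 1"
    using N by (simp_all add: power_mult_distrib power_divide power2_eq_square)
  have distinct: "r\<^sup>2 \<noteq> s\<^sup>2" "r\<^sup>2 \<noteq> r * s" "r * s \<noteq> s\<^sup>2" "1 / (r\<^sup>2 * s\<^sup>2) \<noteq> 1 / (s\<^sup>2 * s\<^sup>2)"
    using generic nonzero by (auto simp: power2_eq_square field_simps)
  \<comment> \<open>The power lemmas need the element to be raised to a power on the left; this
    turns the relations round.\<close>
  have flip: "y * x \<approx> (1 / q) \<bullet> (x * y) + (- (1 / q)) \<bullet> h" if "x * y \<approx> q \<bullet> (y * x) + h" "q \<noteq> 0" for x y q h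
  proof -
    have "(- (1 / q)) \<bullet> (x * y - (q \<bullet> (y * x) + h)) \<in> I"
      using that(1) by (simp only: eqv_def scale_mem)
    thus ?thesis using that(2) by (simp add: eqv_def scale_right_diff_distrib scale_right_distrib algebra_simps)
  qed
  have e4_e3: "e4 * e3 \<approx> (1 / s\<^sup>2) \<bullet> (e3 * e4)" and e3_e1: "e3 * e1 \<approx> (1 / s\<^sup>2) \<bullet> (e1 * e3)"
    using flip[of e3 e4 "s\<^sup>2" 0] flip[of e1 e3 "s\<^sup>2" 0] e3_e4 e1_e3 nonzero by simp_all
  show "central (e1 ^ N)"
  proof (rule centralI_generators[OF generators])
    fix x assume "x \<in> {e1, e2}"
    moreover have "e1 ^ N * e2 \<approx> e2 * e1 ^ N"
      by (rule power_commute[OF _ e1_e3, of _ "r\<^sup>2"]) (use e1_e2 N unity distinct in simp_all)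
    ultimately show "e1 ^ N * x \<approx> x * e1 ^ N"
      by (auto simp: power_commutes)
  qed
  show "central (e2 ^ N)"
  proof (rule centralI_generators[OF generators])
    fix x assume "x \<in> {e1, e2}"
    \<comment> \<open>Here the chain has length three: passing \<open>e2\<close> leads from
      \<open>e1\<close> to \<open>e3\<close>, then to \<open>e4\<close>, where it ends.\<close>
    moreover have "e1 * e2 ^ N \<approx> e2 ^ N * e1"
      by (rule mult_power_commute3[OF _ _ e4_e2, of _ "r\<^sup>2" e3 "r * s"]) (use e1_e2 e3_e2 N unity distinct in simp_all)
    ultimately show "e2 ^ N * x \<approx> x * e2 ^ N"
      by (auto simp: power_commutes intro: eqv_sym)
  qed
  show "central (e3 ^ N)"
  proof (rule centralI_generators[OF generators])
    fix x assume "x \<in> {e1, e2}"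
    moreover have "e3 ^ N * e2 \<approx> e2 * e3 ^ N"
      by (rule power_commute[OF _ e3_e4, of _ "r * s"]) (use e3_e2 N unity distinct in simp_all)
    moreover have "e3 ^ N * e1 \<approx> e1 * e3 ^ N"
      by (rule power_commute_skew[OF e3_e1]) (use unity in simp)
    ultimately show "e3 ^ N * x \<approx> x * e3 ^ N" by auto
  qed
  show "central (e4 ^ N)"
  proof (rule centralI_generators[OF generators])
    fix x assume "x \<in> {e1, e2}"
    moreover have "e4 ^ N * e2 \<approx> e2 * e4 ^ N"
      by (rule power_commute_skew[OF e4_e2]) (use unity in simp)
    moreover have "e4 ^ N * e1 \<approx> e1 * e4 ^ N"
    proof (rule power_commute[OF flip[OF e1_e4]])
      \<comment> \<open>The remainder is a multiple of \<open>e3 * e3\<close>, which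
        \<open>e4\<close> passes by using the twist \<open>1 / s^2\<close> twice.\<close>
      have "e4 * (e3 * e3) \<approx> (1 / s\<^sup>2) \<bullet> (e3 * e4) * e3"
        using eqv_mult_right[OF e4_e3, of e3] by (simp add: mult.assoc)
      also have "\<dots> = (1 / s\<^sup>2) \<bullet> (e3 * (e4 * e3))"
        by (simp add: scale_mult_left mult.assoc)
      also have "\<dots> \<approx> (1 / s\<^sup>2) \<bullet> (e3 * (1 / s\<^sup>2) \<bullet> (e3 * e4))"
        by (intro eqv_scale eqv_mult_left e4_e3)
      finally have "e4 * (e3 * e3) \<approx> (1 / (s\<^sup>2 * s\<^sup>2)) \<bullet> (e3 * e3 * e4)"
        by (simp add: scale_mult_right mult.assoc)
      from eqv_scale[OF this, of "s * (s - r) * - (1 / (r\<^sup>2 * s\<^sup>2))"]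
      show "e4 * (- (1 / (r\<^sup>2 * s\<^sup>2))) \<bullet> (s * (s - r)) \<bullet> (e3 * e3)
          \<approx> (1 / (s\<^sup>2 * s\<^sup>2)) \<bullet> ((- (1 / (r\<^sup>2 * s\<^sup>2))) \<bullet> (s * (s - r)) \<bullet> (e3 * e3) * e4)"
        by (simp only: scale_mult_left scale_mult_right scale_scale mult.commute)
    qed (use N unity distinct nonzero in simp_all)
    ultimately show "e4 ^ N * x \<approx> x * e4 ^ N" by auto
  qed
qed

lemma stable_UNIV:
  assumes "stable e1 B" "stable e2 B"
  shows "stable a B"
proof -
  have "{a. stable a B} = UNIV"
    by (rule generators) (use assms in \<open>auto intro: stable_one stable_add stable_mult stable_scale\<close>)
  thus ?thesis by auto
qed

text \<open>\<open>B4\<close> consists of the ordered monomials with all exponents below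
  \<open>N\<close>. Factors are adjoined on the left in the order \<open>e1\<close>,
  \<open>e3\<close>, \<open>e4\<close>, \<open>e2\<close>.\<close>

lemma finitely_generated_over_center:
  assumes N: "N > 0" "r ^ N = 1" "s ^ N = 1"
  shows "\<exists>B. finite B \<and> (\<forall>a. a \<in> zspan B)"
proof -
  note central = power_central[OF N]
  define B1 where "B1 = power_ext N e1 {1}"
  define B2 where "B2 = power_ext N e3 B1"
  define B3 where "B3 = power_ext N e4 B2"
  define B4 where "B4 = power_ext N e2 B3"
  note self = stable_power_ext_self[OF N(1)] and ext = stable_power_ext[OF N(1)]
  have 1: "stable e1 B1" unfolding B1_def by (rule self[OF central(1)])
  have 2: "stable e3 B2" unfolding B2_def by (rule self[OF central(3)])
  have "stable e1 B2" unfolding B2_def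
    by (rule ext[OF central(3) _ 1 stable_zero]) (use e1_e3 in simp)
  note 2 = 2 this
  have 31: "stable e4 B3" unfolding B3_def by (rule self[OF central(4)])
  \<comment> \<open>This comes before \<open>e1\<close>, whose remainder past \<open>e4\<close> is a
    multiple of \<open>e3 * e3\<close>.\<close>
  have 32: "stable e3 B3" unfolding B3_def
    by (rule ext[OF central(4) _ 2(1) stable_zero]) (use e3_e4 in simp)
  have 33: "stable e1 B3" unfolding B3_def
    by (rule ext[OF central(4) e1_e4 2(2)])
       (use 32 in \<open>auto simp: B3_def intro: stable_scale stable_mult\<close>)
  have 41: "stable e2 B4" unfolding B4_def by (rule self[OF central(2)])
  \<comment> \<open>The order is now \<open>e4\<close>, \<open>e3\<close>, \<open>e1\<close>, since
    the remainder of each past \<open>e2\<close> is a multiple of its predecessor.\<close>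
  have 42: "stable e4 B4" unfolding B4_def
    by (rule ext[OF central(2) _ 31 stable_zero]) (use e4_e2 in simp)
  have 43: "stable e3 B4" unfolding B4_def
    by (rule ext[OF central(2) _ 32 42[unfolded B4_def], of "r * s"]) (simp add: e3_e2)
  have 44: "stable e1 B4" unfolding B4_def
    by (rule ext[OF central(2) _ 33 43[unfolded B4_def], of "r\<^sup>2"]) (simp add: e1_e2)
  have "1 \<in> B4"
    using power_ext_mono[OF N(1)] unfolding B1_def B2_def B3_def B4_def by blast
  hence "a * 1 \<in> zspan B4" for a
    by (intro stableD[OF stable_UNIV[OF 44 41]] zspan.base)
  moreover have "finite B4"
    by (simp add: B1_def B2_def B3_def B4_def finite_power_ext)
  ultimately show ?thesis by auto
qed

end

section \<open>Identities of presented algebras\<close>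

text \<open>Evaluation at representatives in the free algebra, a lift of \<open>eval_free\<close>
  from the quotient.\<close>

definition subst ::
    "('i \<Rightarrow> ('v, 'k) free_algebra) \<Rightarrow> ('i, 'k::field) free_algebra \<Rightarrow> ('v, 'k) free_algebra"
  where "subst P f = (\<Sum>w\<in>Poly_Mapping.keys f.
    scalar (Poly_Mapping.lookup f w) * prod_list (map P (letters w)))"

lemma scalar_zero [simp]: "scalar 0 = 0"
  by (simp add: scalar_def)

lemma scalar_one [simp]: "scalar 1 = 1"
  by (simp add: scalar_def)

lemma scalar_add: "scalar (c + d) = scalar c + scalar d"
  by (simp add: scalar_def single_add)

lemma scalar_mult: "scalar (c * d) = scalar c * scalar d"
  by (simp add: scalar_def mult_single)

lemma scalar_of_int: "scalar (of_int n :: 'k::field) = of_int n"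
  by (simp add: scalar_def)

lemma subst_superset:
  assumes "finite K" "Poly_Mapping.keys f \<subseteq> K"
  shows "subst P f = (\<Sum>w\<in>K. scalar (Poly_Mapping.lookup f w) * prod_list (map P (letters w)))"
  unfolding subst_def using assms
  by (intro sum.mono_neutral_left) (auto simp: in_keys_iff)

lemma subst_zero [simp]: "subst P 0 = 0"
  by (simp add: subst_def)

lemma subst_add: "subst P (f + g) = subst P f + subst P g"
proof -
  let ?K = "Poly_Mapping.keys f \<union> Poly_Mapping.keys g"
  have "subst P h = (\<Sum>w\<in>?K. scalar (Poly_Mapping.lookup h w) * prod_list (map P (letters w)))"
    if "Poly_Mapping.keys h \<subseteq> ?K" for h
    using that by (intro subst_superset) auto
  thus ?thesis using Poly_Mapping.keys_add[of f g]
    by (simp add: lookup_add scalar_add distrib_right sum.distrib)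
qed

lemma subst_sum: "subst P (sum f A) = (\<Sum>a\<in>A. subst P (f a))"
  by (induction A rule: infinite_finite_induct) (simp_all add: subst_add)

lemma subst_single:
  "subst P (Poly_Mapping.single w c) = scalar c * prod_list (map P (letters w))"
  by (simp add: subst_def)

lemma rel_ideal_ideal: "ideal (rel_ideal S) ring_of_type_algebra"
  unfolding rel_ideal_def
  by (rule ring.genideal_ideal[OF ring_free_algebra]) (simp add: ring_of_type_algebra_def)

lemma rel_ideal_generator: "p \<in> S \<Longrightarrow> p \<in> rel_ideal S"
  using ring.genideal_self[OF ring_free_algebra, of S]
  by (auto simp: rel_ideal_def ring_of_type_algebra_def)

lemma algebra_ideal_rel_ideal:
  fixes S :: "('v, 'k::field) free_algebra set"
  shows "algebra_ideal (\<lambda>c p. scalar c * p) (rel_ideal S)"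
proof -
  interpret ideal "rel_ideal S" ring_of_type_algebra by (rule rel_ideal_ideal)
  show ?thesis
  proof
    fix c and x y :: "('v, 'k) free_algebra"
    show "x * (scalar c * y) = scalar c * (x * y)"
      by (metis mult.assoc scalar_commute)
    show "x * y \<in> rel_ideal S" if "y \<in> rel_ideal S"
      using I_l_closed[of y x] that by (simp add: ring_of_type_algebra_def)
    show "y * x \<in> rel_ideal S" if "y \<in> rel_ideal S"
      using I_r_closed[of y x] that by (simp add: ring_of_type_algebra_def)
    show "0 \<in> rel_ideal S"
      using additive_subgroup.zero_closed[OF additive_subgroup_axioms] by (simp add: ring_of_type_algebra_def)
    show "x + y \<in> rel_ideal S" if "x \<in> rel_ideal S" "y \<in> rel_ideal S"
      using additive_subgroup.a_closed[OF additive_subgroup_axioms, of x y] that by (simp add: ring_of_type_algebra_def)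
  qed (simp_all add: scalar_add scalar_mult distrib_left distrib_right mult.assoc)
qed

text \<open>Every assignment in the quotient lifts to some \<open>P\<close>, and the projection is
  an algebra homomorphism with kernel \<open>rel_ideal S\<close>.\<close>

lemma PI_presented_iff:
  fixes S :: "('v, 'k::field) free_algebra set"
  shows "PI_algebra (presented_algebra S) \<longleftrightarrow>
    (\<exists>f :: (nat, 'k) free_algebra. f \<noteq> 0 \<and> (\<forall>P. subst P f \<in> rel_ideal S))"
proof -
  define F where "F = (ring_of_type_algebra :: ('v, 'k) free_algebra ring)"
  define I where "I = rel_ideal S"
  define Q where "Q = F Quot I"
  define A where "A = presented_algebra S"
  define \<pi> where "\<pi> = (+>\<^bsub>F\<^esub>) I"
  have F: "carrier F = UNIV" "x \<otimes>\<^bsub>F\<^esub> y = x * y" "x \<oplus>\<^bsub>F\<^esub> y = x + y" "\<one>\<^bsub>F\<^esub> = 1" "\<zero>\<^bsub>F\<^esub> = 0" for x y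
    by (simp_all add: F_def ring_of_type_algebra_def)
  have A: "carrier A = carrier Q" "monoid.mult A = monoid.mult Q" "\<one>\<^bsub>A\<^esub> = \<one>\<^bsub>Q\<^esub>"
    "\<zero>\<^bsub>A\<^esub> = \<zero>\<^bsub>Q\<^esub>" "add A = add Q" "module.smult A c a = \<pi> (scalar c) \<otimes>\<^bsub>Q\<^esub> a" for c a
    by (simp_all add: A_def presented_algebra_def Let_def Q_def F_def I_def \<pi>_def)
  interpret I: ideal I F unfolding I_def F_def by (rule rel_ideal_ideal)
  interpret pi: ring_hom_ring F Q \<pi> unfolding Q_def \<pi>_def by (rule I.rcos_ring_hom_ring)
  interpret A: assoc_algebra "ring_of_type_algebra :: 'k ring" A
    unfolding A_def by (rule assoc_algebra_presented)
  have \<pi>: "\<pi> p \<in> carrier A" "\<pi> (p * q) = \<pi> p \<otimes>\<^bsub>A\<^esub> \<pi> q" "\<pi> (p + q) = \<pi> p \<oplus>\<^bsub>A\<^esub> \<pi> q"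
    "\<pi> 1 = \<one>\<^bsub>A\<^esub>" "\<pi> 0 = \<zero>\<^bsub>A\<^esub>" "\<pi> (scalar c * p) = c \<odot>\<^bsub>A\<^esub> \<pi> p" for p q c
    using pi.hom_closed[of p] pi.hom_mult[of p q] pi.hom_add[of p q] pi.hom_one pi.hom_zero
      pi.hom_mult[of "scalar c" p]
    by (simp_all add: F A)
  have word: "eval_word A (\<lambda>i. \<pi> (P i)) w = \<pi> (prod_list (map P (letters w)))"
    for P :: "nat \<Rightarrow> _" and w
  proof -
    have "foldr (\<lambda>v. (\<otimes>\<^bsub>A\<^esub>) (\<pi> (P v))) ls \<one>\<^bsub>A\<^esub> = \<pi> (prod_list (map P ls))" for ls
      by (induction ls) (simp_all add: \<pi>)
    thus ?thesis by (simp add: eval_word_def)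
  qed
  have \<pi>_sum: "(\<Oplus>\<^bsub>A\<^esub>w\<in>K. \<pi> (g w)) = \<pi> (sum g K)" if "finite K" for g and K :: "nat word set"
    using that by (induction K) (simp_all add: \<pi> A.M.finsum_insert)
  have eval: "eval_free A (\<lambda>i. \<pi> (P i)) f = \<pi> (subst P f)" for P and f :: "(nat, 'k) free_algebra"
    unfolding eval_free_def subst_def by (simp add: word \<pi>(6)[symmetric] \<pi>_sum)
  have mem: "\<pi> p = \<zero>\<^bsub>A\<^esub> \<longleftrightarrow> p \<in> I" for p
  proof -
    have "p \<in> I" if "I +>\<^bsub>F\<^esub> p = I"
      using I.a_rcos_self[of p] that by (simp add: F)
    moreover have "I +>\<^bsub>F\<^esub> p = I" if "p \<in> I"
      by (rule I.a_rcos_const[OF that])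
    ultimately show ?thesis by (auto simp: A Q_def \<pi>_def FactRing_def)
  qed
  have surj: "\<exists>P. x = (\<lambda>i. \<pi> (P i))" if "\<forall>i. x i \<in> carrier A" for x :: "nat \<Rightarrow> _"
  proof -
    have "\<forall>i. \<exists>p. x i = \<pi> p"
      using that by (simp add: A Q_def \<pi>_def FactRing_def A_RCOSETS_def' F)
    then obtain P where "\<And>i. x i = \<pi> (P i)" using choice by meson
    thus ?thesis by blast
  qed
  have "(\<forall>x. (\<forall>i. x i \<in> carrier A) \<longrightarrow> eval_free A x f = \<zero>\<^bsub>A\<^esub>) \<longleftrightarrow> (\<forall>P. subst P f \<in> I)"
    for f :: "(nat, 'k) free_algebra"
  proof (intro iffI allI impI)
    fix P
    assume "\<forall>x. (\<forall>i. x i \<in> carrier A) \<longrightarrow> eval_free A x f = \<zero>\<^bsub>A\<^esub>"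
    from this[rule_format, of "\<lambda>i. \<pi> (P i)", OF \<pi>(1)] show "subst P f \<in> I"
      by (simp only: eval mem)
  next
    fix x :: "nat \<Rightarrow> _" assume *: "\<forall>P. subst P f \<in> I" and x: "\<forall>i. x i \<in> carrier A"
    obtain P where "x = (\<lambda>i. \<pi> (P i))" using surj[OF x] by (elim exE)
    thus "eval_free A x f = \<zero>\<^bsub>A\<^esub>" using *[rule_format, of P] by (simp only: eval mem)
  qed
  thus ?thesis unfolding PI_algebra_def A_def[symmetric] I_def[symmetric] by simp
qed

definition standard_poly :: "nat \<Rightarrow> (nat, 'k::field) free_algebra"
  where "standard_poly m =
    (\<Sum>\<sigma> | \<sigma> permutes {..<m}. Poly_Mapping.single (Word (map \<sigma> [0..<m])) (of_int (sign \<sigma>)))"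

text \<open>Only the identity permutation produces the word \<open>[0..<m]\<close>, so its
  coefficient is one.\<close>

lemma standard_poly_nonzero: "(standard_poly m :: (nat, 'k::field) free_algebra) \<noteq> 0"
proof -
  have *: "\<sigma> = id" if "\<sigma> permutes {..<m}" "map \<sigma> [0..<m] = [0..<m]" for \<sigma>
  proof
    fix i
    show "\<sigma> i = id i"
      using that permutes_not_in[OF that(1), of i] map_eq_conv[of \<sigma> "[0..<m]" id]
      by (cases "i < m") auto
  qed
  have "Poly_Mapping.lookup (standard_poly m :: (nat, 'k) free_algebra) (Word [0..<m])
      = (\<Sum>\<sigma> | \<sigma> permutes {..<m}. if \<sigma> = id then 1 else 0)"
    unfolding standard_poly_def lookup_sum
    by (intro sum.cong refl) (auto simp: lookup_single when_def dest: *)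
  also have "\<dots> = 1"
    by (simp add: finite_permutations permutes_id)
  finally show ?thesis by auto
qed

lemma subst_standard_poly: "subst P (standard_poly m) = standard_sum m P"
  by (simp add: standard_poly_def standard_sum_def subst_sum subst_single scalar_of_int comp_def)

section \<open>The quantum plane\<close>

text \<open>These operators satisfy \<open>E1 E2 = q E2 E1\<close>.\<close>

fun qplane_op :: "'k::field \<Rightarrow> B2_gen \<Rightarrow> (nat \<Rightarrow> 'k) \<Rightarrow> nat \<Rightarrow> 'k" where
  "qplane_op q E1 v n = v (Suc n)"
| "qplane_op q E2 v n = q ^ n * v n"

definition qplane_word :: "'k::field \<Rightarrow> B2_gen word \<Rightarrow> (nat \<Rightarrow> 'k) \<Rightarrow> nat \<Rightarrow> 'k"
  where "qplane_word q w = foldr (qplane_op q) (letters w)"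

definition qplane :: "'k::field \<Rightarrow> (B2_gen, 'k) free_algebra \<Rightarrow> (nat \<Rightarrow> 'k) \<Rightarrow> nat \<Rightarrow> 'k"
  where "qplane q p v n =
    (\<Sum>w\<in>Poly_Mapping.keys p. Poly_Mapping.lookup p w * qplane_word q w v n)"

lemma qplane_word_linear:
  "qplane_word q w (\<lambda>n. \<Sum>a\<in>A. c a * f a n) n = (\<Sum>a\<in>A. c a * qplane_word q w (f a) n)"
proof -
  have "qplane_op q x (\<lambda>n. \<Sum>a\<in>A. c a * f a n) = (\<lambda>n. \<Sum>a\<in>A. c a * qplane_op q x (f a) n)"
    for x and f :: "'b \<Rightarrow> nat \<Rightarrow> 'a"
    by (cases x) (auto simp: sum_distrib_left mult_ac)
  hence "foldr (qplane_op q) ls (\<lambda>n. \<Sum>a\<in>A. c a * f a n)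
      = (\<lambda>n. \<Sum>a\<in>A. c a * foldr (qplane_op q) ls (f a) n)" for ls
    by (induction ls) auto
  thus ?thesis by (simp add: qplane_word_def)
qed

lemma qplane_superset:
  assumes "finite K" "Poly_Mapping.keys p \<subseteq> K"
  shows "qplane q p v n = (\<Sum>w\<in>K. Poly_Mapping.lookup p w * qplane_word q w v n)"
  unfolding qplane_def using assms
  by (intro sum.mono_neutral_left) (auto simp: in_keys_iff)

lemma qplane_zero [simp]: "qplane q 0 v n = 0"
  by (simp add: qplane_def)

lemma qplane_add: "qplane q (f + g) v n = qplane q f v n + qplane q g v n"
proof -
  let ?K = "Poly_Mapping.keys f \<union> Poly_Mapping.keys g"
  have "qplane q h v n = (\<Sum>w\<in>?K. Poly_Mapping.lookup h w * qplane_word q w v n)"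
    if "Poly_Mapping.keys h \<subseteq> ?K" for h
    using that by (intro qplane_superset) auto
  thus ?thesis using Poly_Mapping.keys_add[of f g]
    by (simp add: lookup_add distrib_right sum.distrib)
qed

lemma qplane_diff: "qplane q (f - g) v n = qplane q f v n - qplane q g v n"
  using qplane_add[of q "f - g" g v n] by simp

lemma qplane_sum: "qplane q (sum f A) v n = (\<Sum>a\<in>A. qplane q (f a) v n)"
  by (induction A rule: infinite_finite_induct) (simp_all add: qplane_add)

lemma qplane_single: "qplane q (Poly_Mapping.single w c) v n = c * qplane_word q w v n"
  by (simp add: qplane_def)

lemma sum_singles: "(\<Sum>w\<in>Poly_Mapping.keys p. Poly_Mapping.single w (Poly_Mapping.lookup p w)) = p"
  by (rule poly_mapping_eqI)
     (auto simp: lookup_sum lookup_single when_def in_keys_iff)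

lemma qplane_mult: "qplane q (f * g) v = qplane q f (qplane q g v)"
proof
  fix n
  let ?c = "\<lambda>p w. Poly_Mapping.lookup p w" and ?K = Poly_Mapping.keys
  have "f * g = (\<Sum>u\<in>?K f. \<Sum>w\<in>?K g. Poly_Mapping.single (u + w) (?c f u * ?c g w))"
    by (subst (1 2) sum_singles[symmetric])
       (simp add: sum_product mult_single)
  hence "qplane q (f * g) v n
      = (\<Sum>u\<in>?K f. \<Sum>w\<in>?K g. ?c f u * ?c g w * qplane_word q (u + w) v n)"
    by (simp add: qplane_sum qplane_single)
  also have "\<dots> = (\<Sum>u\<in>?K f. ?c f u * (\<Sum>w\<in>?K g. ?c g w * qplane_word q u (qplane_word q w v) n))"
    by (simp add: qplane_word_def plus_word_def sum_distrib_left mult.assoc)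
  also have "\<dots> = qplane q f (qplane q g v) n"
    unfolding qplane_word_linear[symmetric] by (simp add: qplane_def[abs_def])
  finally show "qplane q (f * g) v n = qplane q f (qplane q g v) n" .
qed

lemma qplane_scalar: "qplane q (scalar c) v n = c * v n"
  by (simp add: scalar_def qplane_single qplane_word_def zero_word_def)

lemma qplane_one [simp]: "qplane q 1 v = v"
  using qplane_scalar[of q 1 v] by (simp add: fun_eq_iff)

lemma qplane_gen: "qplane q (gen x) v = qplane_op q x v"
  by (rule ext) (simp add: gen_def qplane_single qplane_word_def)

text \<open>The annihilator of the representation is a two-sided ideal, so it contains
  \<open>rel_ideal S\<close> as soon as it contains \<open>S\<close>.\<close>

lemma qplane_rel_ideal:
  assumes S: "\<And>p v n. p \<in> S \<Longrightarrow> qplane q p v n = 0" and p: "p \<in> rel_ideal S"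
  shows "qplane q p v n = 0"
proof -
  define J where "J = {p. \<forall>v n. qplane q p v n = 0}"
  interpret ring "ring_of_type_algebra :: (B2_gen, 'a) free_algebra ring"
    by (rule ring_free_algebra)
  \<comment> \<open>The case of the empty sum in linearity.\<close>
  have zero: "qplane q f (\<lambda>_. 0) n = 0" for f n
    using qplane_word_linear[of q _ _ _ "{}"] by (simp add: qplane_def)
  have "ideal J ring_of_type_algebra"
  proof (rule idealI[OF ring_free_algebra])
    show "subgroup J (add_monoid ring_of_type_algebra)"
    proof (rule group.subgroupI[OF a_group])
      fix p assume p: "p \<in> J"
      have "\<ominus>\<^bsub>ring_of_type_algebra\<^esub> p = - p"
        by (rule minus_equality) (simp_all add: ring_of_type_algebra_def)
      moreover have "- p \<in> J" using p qplane_diff[of q 0 p] by (simp add: J_def)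
      ultimately show "inv\<^bsub>add_monoid ring_of_type_algebra\<^esub> p \<in> J"
        by (simp add: a_inv_def)
    next
      show "J \<noteq> {}" using qplane_zero unfolding J_def by blast
    qed (auto simp: J_def ring_of_type_algebra_def qplane_add)
  next
    fix a x :: "(B2_gen, 'a) free_algebra" assume "a \<in> J"
    hence "qplane q a v = (\<lambda>_. 0)" for v by (auto simp: J_def)
    thus "x \<otimes>\<^bsub>ring_of_type_algebra\<^esub> a \<in> J" "a \<otimes>\<^bsub>ring_of_type_algebra\<^esub> x \<in> J"
      by (simp_all add: J_def ring_of_type_algebra_def qplane_mult zero)
  qed
  hence "rel_ideal S \<subseteq> J"
    unfolding rel_ideal_def by (rule genideal_minimal) (auto simp: J_def S)
  thus ?thesis using p by (auto simp: J_def)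
qed

text \<open>In the quantum plane the relations become multiples of
  \<open>(q - r^2) (q - s^2)\<close> and \<open>(q - r^2) (q - r s) (q - s^2)\<close>, which vanish
  at \<open>q = r^2\<close>.\<close>

lemma qplane_B2_relations:
  assumes "p \<in> B2_relations r s" "q = r^2"
  shows "qplane q p v n = 0"
  using assms unfolding B2_relations_def Let_def
  by (elim insertE emptyE; hypsubst)
     (simp_all add: qplane_add qplane_diff qplane_mult qplane_scalar qplane_gen
      power2_eq_square power3_eq_cube algebra_simps)

lemma qplane_prod:
  "qplane q (prod_list (map (\<lambda>j. gen E2 - scalar (q ^ j)) L)) v n
    = prod_list (map (\<lambda>j. q ^ n - q ^ j) L) * v n"
  by (induction L arbitrary: v n)
     (simp_all add: qplane_mult qplane_diff qplane_scalar qplane_gen algebra_simps)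

text \<open>Reading the value at \<open>0\<close> isolates the coefficient of one chosen word
  \<open>w\<close>: the vector \<open>v\<close> discards words of other lengths, the polynomials in
  \<open>E2\<close> discard the other words of length \<open>k\<close>.\<close>

lemma qplane_no_identity:
  fixes f :: "(nat, 'k::field) free_algebra"
  assumes inj: "inj (\<lambda>n. q ^ n :: 'k)" and f: "f \<noteq> 0"
  shows "\<exists>P v n. qplane q (subst P f) v n \<noteq> 0"
proof -
  obtain w where w: "w \<in> Poly_Mapping.keys f" using f by (metis all_not_in_conv keys_eq_empty)
  define k where "k = length (letters w)"
  \<comment> \<open>The positions at which \<open>w\<close> does not carry the letter
    \<open>i\<close>; \<open>P i\<close> is built to vanish exactly there among the first
    \<open>k\<close>.\<close>
  define L where "L i = filter (\<lambda>j. letters w ! j \<noteq> i) [0..<k]" for i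
  define c where "c i n = prod_list (map (\<lambda>j. q ^ n - q ^ j) (L i))" for i n
  define P where "P i = prod_list (map (\<lambda>j. gen E2 - scalar (q ^ j)) (L i)) * gen E1" for i
  define v where "v n = (if n = k then 1 else 0 :: 'k)" for n
  have c: "c i n = 0 \<longleftrightarrow> i \<noteq> letters w ! n" if "n < k" for i n
    using that inj by (auto simp: c_def L_def prod_list_zero_iff inj_eq image_iff)
  \<comment> \<open>Each factor \<open>P i\<close> ends in the shift \<open>gen E1\<close>, so the
    \<open>j\<close>-th letter is tested at position \<open>n + j\<close>.\<close>
  have word: "qplane q (prod_list (map P ls)) v n = (\<Prod>j<length ls. c (ls ! j) (n + j)) * v (n + length ls)"
    for ls n
    by (induction ls arbitrary: n)
       (simp_all add: P_def qplane_mult qplane_prod qplane_gen c_def prod.lessThan_Suc_shift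
          mult.assoc del: prod.lessThan_Suc)
  have zero: "qplane q (prod_list (map P (letters u))) v 0 = 0" if "u \<noteq> w" for u
  proof (cases "length (letters u) = k")
    case True
    hence "\<exists>j<k. letters u ! j \<noteq> letters w ! j"
      using that by (metis k_def nth_equalityI word.expand)
    thus ?thesis using c True by (auto simp: word)
  qed (simp add: word v_def)
  have "qplane q (subst P f) v 0 =
      (\<Sum>u\<in>Poly_Mapping.keys f. Poly_Mapping.lookup f u * qplane q (prod_list (map P (letters u))) v 0)"
    by (simp add: subst_def qplane_sum qplane_mult qplane_scalar)
  also have "\<dots> = Poly_Mapping.lookup f w * qplane q (prod_list (map P (letters w))) v 0"
    using w zero by (subst sum.remove[of _ w]) (auto intro!: sum.neutral)
  also have "\<dots> \<noteq> 0"
    using w c by (auto simp: word v_def k_def[symmetric] in_keys_iff)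
  finally show ?thesis by blast
qed

lemma power_inj:
  assumes "q \<noteq> 0" "\<And>n. n > 0 \<Longrightarrow> q ^ n \<noteq> (1::'k::field)"
  shows "inj (\<lambda>n. q ^ n)"
proof (rule linorder_injI)
  fix m n :: nat assume "m < n"
  hence "q ^ n = q ^ m * q ^ (n - m)" by (simp flip: power_add)
  thus "q ^ m \<noteq> q ^ n" using assms \<open>m < n\<close> by auto
qed

lemma B2_relations_commute: "B2_relations r s = B2_relations s r"
  by (simp add: B2_relations_def Let_def algebra_simps)

lemma PI_imp_root_of_unity:
  assumes PI: "PI_algebra (U_plus_B2 r s)" and r: "r \<noteq> 0"
  shows "root_of_unity r"
proof (rule ccontr)
  assume nr: "\<not> root_of_unity r"
  \<comment> \<open>If \<open>r\<close> is not a root of unity, neither is its square, so the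
    diagonal entries are distinct.\<close>
  have "inj (\<lambda>n. (r^2) ^ n)"
  proof (rule power_inj)
    fix n :: nat assume "n > 0"
    thus "(r^2) ^ n \<noteq> 1"
      using nr unfolding root_of_unity_def power_mult[symmetric] by (metis nat_0_less_mult_iff zero_less_numeral)
  qed (use r in simp)
  moreover obtain f :: "(nat, complex) free_algebra" where "f \<noteq> 0"
    "\<And>P. subst P f \<in> rel_ideal (B2_relations r s)"
    using PI by (auto simp: U_plus_B2_def PI_presented_iff)
  ultimately show False
    using qplane_no_identity[of "r^2" f] qplane_rel_ideal[of "B2_relations r s" "r^2"]
      qplane_B2_relations by blast
qed

section \<open>The PI property for type B2\<close>

lemma B2_ideal_free:
  assumes "r \<noteq> 0" "s \<noteq> 0" "r^2 \<noteq> s^2"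
  shows "B2_ideal (\<lambda>c p. scalar c * p) (rel_ideal (B2_relations r s)) (gen E1) (gen E2) r s"
proof (intro B2_ideal.intro B2_ideal_axioms.intro algebra_ideal_rel_ideal)
  fix W :: "(B2_gen, complex) free_algebra set"
  assume one: "1 \<in> W" and gen: "\<And>x. x \<in> {gen E1, gen E2} \<Longrightarrow> x \<in> W"
    and add: "\<And>a b. a \<in> W \<Longrightarrow> b \<in> W \<Longrightarrow> a + b \<in> W"
    and mult: "\<And>a b. a \<in> W \<Longrightarrow> b \<in> W \<Longrightarrow> a * b \<in> W"
    and scale: "\<And>c a. a \<in> W \<Longrightarrow> scalar c * a \<in> W"
  have gen: "gen x \<in> W" for x using gen by (cases x) auto
  have word: "Poly_Mapping.single (Word ls) 1 \<in> W" for ls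
  proof (induction ls)
    case Nil
    show ?case using one by (simp add: zero_word_def[symmetric])
  next
    case (Cons x ls)
    thus ?case using mult[OF gen[of x] Cons] by (simp add: gen_def mult_single plus_word_def)
  qed
  have "Poly_Mapping.single w c \<in> W" for w c
    using scale[OF word[of "letters w"], of c] by (simp add: scalar_def mult_single)
  \<comment> \<open>The scalar \<open>0\<close> applied to \<open>1\<close> puts zero into
    \<open>W\<close>, which covers the empty sum.\<close>
  hence "(\<Sum>w\<in>K. Poly_Mapping.single w (g w)) \<in> W" for K g
    using scale[OF one, of 0] by (induction K rule: infinite_finite_induct) (auto intro: add)
  hence "p \<in> W" for p using sum_singles[of p] by metis
  thus "W = UNIV" by blast
qed (use assms in \<open>auto intro!: rel_ideal_generator simp: B2_relations_def Let_def\<close>)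

theorem theorem2p4:
  fixes r s :: complex
  assumes "r \<noteq> 0" and "s \<noteq> 0" and "r^2 \<noteq> s^2"
  shows "PI_algebra (U_plus_B2 r s) \<longleftrightarrow> root_of_unity r \<and> root_of_unity s"
proof
  assume "PI_algebra (U_plus_B2 r s)"
  thus "root_of_unity r \<and> root_of_unity s"
    using assms PI_imp_root_of_unity[of r s] PI_imp_root_of_unity[of s r]
    by (simp add: U_plus_B2_def B2_relations_commute[of s r])
next
  assume "root_of_unity r \<and> root_of_unity s"
  then obtain a b where ab: "a > 0" "r ^ a = 1" "b > 0" "s ^ b = 1"
    by (auto simp: root_of_unity_def)
  interpret B2_ideal "\<lambda>c p. scalar c * p" "rel_ideal (B2_relations r s)" "gen E1" "gen E2" r s
    by (rule B2_ideal_free[OF assms])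
  \<comment> \<open>The product \<open>a * b\<close> serves as a common exponent \<open>N\<close>
    for \<open>r\<close> and \<open>s\<close>.\<close>
  have "s ^ (a * b) = 1" using ab by (simp add: mult.commute[of a b] power_mult)
  then obtain B where B: "finite B" "\<And>x. x \<in> zspan B"
    using finitely_generated_over_center[of "a * b"] ab by (auto simp: power_mult)
  \<comment> \<open>The degree exceeds the size of the generating set by one, as the pigeonhole
    argument requires.\<close>
  have "subst P (standard_poly (Suc (card B))) \<in> rel_ideal (B2_relations r s)" for P
    unfolding subst_standard_poly by (rule standard_sum_mem[OF _ B(1) _ B(2)]) simp_all
  thus "PI_algebra (U_plus_B2 r s)"
    unfolding U_plus_B2_def PI_presented_iff using standard_poly_nonzero by blast
qed

end
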